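(* Let $(T,\mathcal{C},\mathcal{I},A)$ be a storyline instance. There exists a storyline solution $S=(\pi_1,\dots,\pi_\ell)$ with the minimum number of crossings such that for every $i\in\{2,\dots,\ell\}$ with $|\mathcal{I}(t_i)|=1$, say $\mathcal{I}(t_i)=\{I\}$, the following hold: (1) there exist sets $C_a,C_b$ with $\pi_i=\pi_i[C_a]\star\pi_i[\operatorname{char}(I)]\star\pi_i[C_b]$ (i.e. $C_a$ is the set of characters before and $C_b$ the set of characters after $\operatorname{char}(I)$ in $\pi_i$); (2) if $C_a\subseteq\operatorname{AC}(t_{i-1},t_i)$, then $\pi_i[C_a]=\pi_{i-1}[C_a]$; (3) if $\operatorname{char}(I)\subseteq\operatorname{AC}(t_{i-1},t_i)$, then $\pi_i[\operatorname{char}(I)]=\pi_{i-1}[\operatorname{char}(I)]$; (4) if $C_b\subseteq\operatorname{AC}(t_{i-1},t_i)$, then $\pi_i[C_b]=\pi_{i-1}[C_b]$.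
   Context: A storyline instance $(T,\mathcal{C},\mathcal{I},A)$ consists of totally ordered time steps $T=\{t_1,\dots,t_\ell\}$, a set of characters $\mathcal{C}$, a set of interactions $\mathcal{I}$, where each interaction $I$ has a time step $\operatorname{time}(I)\in T$ and a character set $\operatorname{char}(I)\subseteq\mathcal{C}$, and a map $A$ assigning to each character $c$ a set of consecutive time steps $A(c)=\{t_i,\dots,t_j\}$ (the steps at which $c$ is active). Let $\operatorname{AC}(t)=\{c: t\in A(c)\}$, $\operatorname{AC}(t_i,t_j)=\operatorname{AC}(t_i)\cap\dots\cap\operatorname{AC}(t_j)$, and $\mathcal{I}(t)=\{I:\operatorname{time}(I)=t\}$. It is assumed that $\operatorname{char}(I)\subseteq\operatorname{AC}(\operatorname{time}(I))$ for all $I$, that $\mathcal{I}(t)\neq\emptyset$ for every $t$, and that the character sets of the interactions at a common time step are pairwise disjoint. A storyline solution is a sequence $S=(\pi_1,\dots,\pi_\ell)$ where $\pi_i$ is a permutation (linear order) of $\operatorname{AC}(t_i)$ in which, for every $I\in\mathcal{I}(t_i)$, the characters of $\operatorname{char}(I)$ appear consecutively. For a permutation $\pi$ of $X$ and $Y\subseteq X$, $\pi[Y]$ denotes the restriction of $\pi$ to $Y$; $\pi\star\phi$ denotes concatenation of permutations of disjoint sets. For consecutive steps, $\operatorname{cr}(\pi_i,\pi_{i+1})$ is the number of pairs $\{c,c'\}\subseteq C=\operatorname{AC}(t_i)\cap\operatorname{AC}(t_{i+1})$ whose relative order differs in $\pi_i[C]$ and $\pi_{i+1}[C]$, and the number of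 crossings of $S$ is $\operatorname{cr}(S)=\sum_{i=1}^{\ell-1}\operatorname{cr}(\pi_i,\pi_{i+1})$. *)

theory Defs
  imports Main "HOL-Library.Sublist" "HOL-Combinatorics.Multiset_Permutations"
begin

text \<open>
  The totally ordered time steps are given as a list without repetitions, so the step
  \<open>t\<^sub>i\<close> of the 1-based mathematical notation is \<open>steps P ! (i - 1)\<close>. All indices below are
  0-based. Interactions are abstract objects carrying a time step and a character set.
\<close>

record ('t, 'c, 'i) storyline =
  steps :: "'t list"
  characters :: "'c set"
  interactions :: "'i set"
  itime :: "'i \<Rightarrow> 't"
  ichars :: "'i \<Rightarrow> 'c set"
  active :: "'c \<Rightarrow> 't set"

definition AC :: "('t, 'c, 'i) storyline \<Rightarrow> 't \<Rightarrow> 'c set" where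
  "AC P t = {c \<in> characters P. t \<in> active P c}"

definition AC_range :: "('t, 'c, 'i) storyline \<Rightarrow> nat \<Rightarrow> nat \<Rightarrow> 'c set" where
  "AC_range P i j = (\<Inter>k\<in>{i..j}. AC P (steps P ! k))"

definition interactions_at :: "('t, 'c, 'i) storyline \<Rightarrow> 't \<Rightarrow> 'i set" where
  "interactions_at P t = {I \<in> interactions P. itime P I = t}"

definition storyline_instance :: "('t, 'c, 'i) storyline \<Rightarrow> bool" where
  "storyline_instance P \<longleftrightarrow>
     distinct (steps P) \<and>
     finite (characters P) \<and>
     (\<forall>I \<in> interactions P. itime P I \<in> set (steps P)) \<and>
     (\<forall>c \<in> characters P. \<exists>i j. i \<le> j \<and> j < length (steps P) \<and>
        active P c = (\<lambda>k. steps P ! k) ` {i..j}) \<and>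
     (\<forall>I \<in> interactions P. ichars P I \<subseteq> AC P (itime P I)) \<and>
     (\<forall>t \<in> set (steps P). interactions_at P t \<noteq> {}) \<and>
     (\<forall>t \<in> set (steps P).
        pairwise (\<lambda>I J. disjnt (ichars P I) (ichars P J)) (interactions_at P t))"

text \<open>
  A permutation of a finite set \<open>X\<close> is a list in \<^term>\<open>permutations_of_set X\<close>;
  concatenation is \<^term>\<open>(@)\<close>.
\<close>

definition restrict_perm :: "'c list \<Rightarrow> 'c set \<Rightarrow> 'c list" where
  "restrict_perm p Y = filter (\<lambda>c. c \<in> Y) p"

definition consecutive_in :: "'c set \<Rightarrow> 'c list \<Rightarrow> bool" where
  "consecutive_in Y p \<longleftrightarrow> (\<exists>ys. sublist ys p \<and> set ys = Y)"

definition storyline_solution :: "('t, 'c, 'i) storyline \<Rightarrow> 'c list list \<Rightarrow> bool" where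
  "storyline_solution P S \<longleftrightarrow>
     length S = length (steps P) \<and>
     (\<forall>i < length (steps P).
        S ! i \<in> permutations_of_set (AC P (steps P ! i)) \<and>
        (\<forall>I \<in> interactions_at P (steps P ! i). consecutive_in (ichars P I) (S ! i)))"

text \<open>In a list without repetitions, \<open>subseq [c, c'] p\<close> says that \<open>c\<close> occurs before \<open>c'\<close>.\<close>

definition precedes :: "'c list \<Rightarrow> 'c \<Rightarrow> 'c \<Rightarrow> bool" where
  "precedes p c c' \<longleftrightarrow> subseq [c, c'] p"

definition step_crossings :: "'c list \<Rightarrow> 'c list \<Rightarrow> nat" where
  "step_crossings p q =
     (let C = set p \<inter> set q in
      card {{c, c'} | c c'. c \<in> C \<and> c' \<in> C \<and> c \<noteq> c' \<and>
        precedes (restrict_perm p C) c c' \<noteq> precedes (restrict_perm q C) c c'})"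

definition crossings :: "'c list list \<Rightarrow> nat" where
  "crossings S = (\<Sum>i < length S - 1. step_crossings (S ! i) (S ! Suc i))"

end

theory Submission imports Defs begin

text \<open>
  Take a solution with the fewest crossings and repair its steps from left to right. If the block
  \<open>Ca\<close>, \<open>char(I)\<close> or \<open>Cb\<close> at step \<open>i\<close> is active at step \<open>i - 1\<close>, copy its order from there.
  By the triangle inequality for inversions, the pairs reordered in this way cost at most as much
  between steps \<open>i\<close> and \<open>i + 1\<close> as they save between steps \<open>i - 1\<close> and \<open>i\<close>, so the solution stays
  optimal. The repair at step \<open>i\<close> leaves the earlier permutations alone, so the properties already
  established for them persist.
\<close>

section \<open>Precedence in lists, inversions and crossing counts\<close>

lemma precedes_Cons:
  "precedes (a # p) c d \<longleftrightarrow> precedes p c d \<or> (a = c \<and> d \<in> set p)"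
  unfolding precedes_def by (auto simp: subseq_singleton_left dest: subseq_Cons')

lemma precedes_Nil [simp]: "\<not> precedes [] c d"
  by (simp add: precedes_def)

lemma precedes_append:
  "precedes (p @ q) c d \<longleftrightarrow> precedes p c d \<or> precedes q c d \<or> (c \<in> set p \<and> d \<in> set q)"
  by (induction p) (auto simp: precedes_Cons)

lemma precedes_in_set: "precedes p c d \<Longrightarrow> c \<in> set p \<and> d \<in> set p"
  by (induction p) (auto simp: precedes_Cons)

lemma precedes_antisym: "distinct p \<Longrightarrow> precedes p c d \<Longrightarrow> \<not> precedes p d c"
  by (induction p) (auto simp: precedes_Cons dest: precedes_in_set)

lemma precedes_total:
  "c \<in> set p \<Longrightarrow> d \<in> set p \<Longrightarrow> c \<noteq> d \<Longrightarrow> precedes p c d \<or> precedes p d c"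
  by (induction p) (auto simp: precedes_Cons)

lemma precedes_restrict_perm:
  "precedes (restrict_perm p Y) c d \<longleftrightarrow> precedes p c d \<and> c \<in> Y \<and> d \<in> Y"
  by (induction p) (auto simp: precedes_Cons restrict_perm_def)

definition inversions :: "'c list \<Rightarrow> 'c list \<Rightarrow> ('c \<times> 'c) set" where
  "inversions p q = {(c, d). precedes p c d \<and> precedes q d c}"

lemma finite_inversions: "finite (inversions p q)"
  by (rule finite_subset[of _ "set p \<times> set p"])
    (auto simp: inversions_def dest: precedes_in_set)

text \<open>Orienting each crossing pair by its order in \<open>p\<close> turns two-element sets
  into ordered pairs. Distinctness makes precedence antisymmetric, so \<open>?f\<close> never
  identifies two of these.\<close>

lemma step_crossings_eq_card_inversions:
  assumes "distinct p" "distinct q"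
  shows "step_crossings p q = card (inversions p q)"
proof -
  let ?C = "set p \<inter> set q"
  let ?f = "\<lambda>(c, d). {c, d}"
  have inj: "inj_on ?f (inversions p q)"
    using precedes_antisym[OF assms(1)]
    by (auto simp: inj_on_def inversions_def doubleton_eq_iff)
  have "{{c, d} | c d. c \<in> ?C \<and> d \<in> ?C \<and> c \<noteq> d \<and>
      precedes (restrict_perm p ?C) c d \<noteq> precedes (restrict_perm q ?C) c d}
    = ?f ` inversions p q" (is "?L = ?R")
  proof (intro subset_antisym subsetI)
    fix x assume "x \<in> ?L"
    then obtain c d where x: "x = {c, d}" and cd: "c \<in> ?C" "d \<in> ?C" "c \<noteq> d"
      and "precedes p c d \<noteq> precedes q c d"
      by (auto simp: precedes_restrict_perm)
    then have "(c, d) \<in> inversions p q \<or> (d, c) \<in> inversions p q"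
      using precedes_total[of c p d] precedes_total[of c q d] unfolding inversions_def by auto
    then show "x \<in> ?R" unfolding x by (force simp: insert_commute)
  next
    fix x assume "x \<in> ?R"
    then obtain c d where x: "x = {c, d}" and cd: "precedes p c d" "precedes q d c"
      by (auto simp: inversions_def)
    have "c \<noteq> d" "c \<in> ?C" "d \<in> ?C" "\<not> precedes q c d"
      using cd precedes_antisym[OF assms(1)] precedes_antisym[OF assms(2)]
      by (auto dest: precedes_in_set)
    then show "x \<in> ?L" using x cd by (auto simp: precedes_restrict_perm)
  qed
  then show ?thesis
    unfolding step_crossings_def Let_def by (simp add: card_image[OF inj])
qed

text \<open>The second hypothesis expresses that \<open>q'\<close> departs from \<open>q\<close>
  only to follow \<open>p\<close>. An order in \<open>q'\<close> that contradicts \<open>p\<close>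
  cannot have come from \<open>p\<close>, so it was already present in \<open>q\<close>.\<close>

lemma inversions_towards_left:
  assumes "distinct p"
    and "\<And>c d. precedes q' c d \<Longrightarrow> precedes q c d \<or> precedes p c d"
  shows "inversions p q' \<subseteq> inversions p q"
  using assms by (auto simp: inversions_def dest: precedes_antisym)

text \<open>Let \<open>X\<close> collect the pairs switched from the order of \<open>q\<close> to
  that of \<open>p\<close>. Each of them is an inversion between \<open>p\<close> and
  \<open>q\<close> that \<open>q'\<close> removes, and every inversion against \<open>r\<close> that
  \<open>q'\<close> creates lies in \<open>X\<close>. Hence the saving on the left is at least
  \<open>card X\<close> and the cost on the right at most \<open>card X\<close>.\<close>

lemma card_inversions_triangle:
  assumes "distinct p" "distinct q'" "set q' = set q"
    and towards: "\<And>c d. precedes q' c d \<Longrightarrow> precedes q c d \<or> precedes p c d"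
  shows "card (inversions p q') + card (inversions q' r)
    \<le> card (inversions p q) + card (inversions q r)"
proof -
  define X where "X = {(c, d). precedes p c d \<and> precedes q d c \<and> precedes q' c d}"
  have X: "X \<subseteq> inversions p q" by (auto simp: X_def inversions_def)
  have disj: "inversions p q' \<inter> X = {}"
    using assms(2) by (auto simp: X_def inversions_def dest: precedes_antisym)
  have fin: "finite X" using X finite_inversions by (rule finite_subset)
  have "card (inversions p q') + card X = card (inversions p q' \<union> X)"
    using disj fin by (simp add: card_Un_disjoint finite_inversions)
  also have "\<dots> \<le> card (inversions p q)"
    using X inversions_towards_left[OF assms(1) towards]
    by (intro card_mono finite_inversions) auto
  finally have left: "card (inversions p q') + card X \<le> card (inversions p q)" .
  have "inversions q' r \<subseteq> inversions q r \<union> X"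
  proof clarify
    fix c d assume cd: "(c, d) \<in> inversions q' r" "(c, d) \<notin> X"
    then have q': "precedes q' c d" and r: "precedes r d c" by (auto simp: inversions_def)
    \<comment> \<open>Equal underlying sets make \<open>c\<close> and \<open>d\<close> comparable in
      \<open>q\<close>. If \<open>d\<close> came first there, \<open>towards\<close> would take the
      order from \<open>p\<close> and put the pair into \<open>X\<close>, which is excluded.\<close>
    have "c \<in> set q" "d \<in> set q" "c \<noteq> d"
      using q' assms(2,3) by (auto dest: precedes_in_set precedes_antisym)
    then show "(c, d) \<in> inversions q r"
      using towards[OF q'] cd(2) q' r precedes_total[of c q d]
      by (auto simp: inversions_def X_def)
  qed
  then have "card (inversions q' r) \<le> card (inversions q r \<union> X)"
    using fin by (intro card_mono) (auto simp: finite_inversions)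
  also have "\<dots> \<le> card (inversions q r) + card X" by (rule card_Un_le)
  finally show ?thesis using left by simp
qed

text \<open>Only the summands \<open>n\<close> and \<open>Suc n\<close> involve the replaced
  permutation, so the comparison is local.\<close>

lemma crossings_update_le:
  assumes n: "Suc n < length S"
    and dist: "\<And>i. i < length S \<Longrightarrow> distinct (S ! i)"
    and q': "distinct q'" "set q' = set (S ! Suc n)"
    and towards: "\<And>c d. precedes q' c d \<Longrightarrow> precedes (S ! Suc n) c d \<or> precedes (S ! n) c d"
  shows "crossings (S[Suc n := q']) \<le> crossings S"
proof -
  let ?p = "S ! n" and ?q = "S ! Suc n" and ?r = "S ! Suc (Suc n)"
  define f where "f i = step_crossings (S ! i) (S ! Suc i)" for i
  define g where "g i = step_crossings (S[Suc n := q'] ! i) (S[Suc n := q'] ! Suc i)" for i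
  let ?K = "{..<length S - 1}"
  have rest: "(\<Sum>i \<in> ?K - {n, Suc n}. g i) = (\<Sum>i \<in> ?K - {n, Suc n}. f i)"
    by (rule sum.cong) (auto simp: f_def g_def)
  have gn: "g n = card (inversions ?p q')" and fn: "f n = card (inversions ?p ?q)"
    unfolding f_def g_def using n q' dist by (simp_all add: step_crossings_eq_card_inversions)
  \<comment> \<open>Intersecting with \<open>?K\<close> drops the summand \<open>Suc n\<close> when
    the last permutation is replaced. There is then no cost on the right, and the inclusion of
    inversions suffices.\<close>
  have "(\<Sum>i \<in> ?K \<inter> {n, Suc n}. g i) \<le> (\<Sum>i \<in> ?K \<inter> {n, Suc n}. f i)"
  proof (cases "Suc (Suc n) < length S")
    case True
    then have K: "?K \<inter> {n, Suc n} = {n, Suc n}" by auto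
    have "g (Suc n) = card (inversions q' ?r)" "f (Suc n) = card (inversions ?q ?r)"
      unfolding f_def g_def using True q' dist
      by (simp_all add: step_crossings_eq_card_inversions)
    then show ?thesis
      unfolding K using card_inversions_triangle[of ?p q' ?q ?r, OF _ q' towards] dist n gn fn
      by simp
  next
    case False
    then have K: "?K \<inter> {n, Suc n} = {n}" using n by auto
    have "g n \<le> f n"
      unfolding gn fn using inversions_towards_left[of ?p q' ?q, OF _ towards] dist n
      by (intro card_mono finite_inversions) auto
    then show ?thesis unfolding K by simp
  qed
  then have "(\<Sum>i \<in> ?K. g i) \<le> (\<Sum>i \<in> ?K. f i)"
    using rest sum.Int_Diff[OF finite_lessThan, of g "length S - 1" "{n, Suc n}"]
      sum.Int_Diff[OF finite_lessThan, of f "length S - 1" "{n, Suc n}"] by linarith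
  then show ?thesis by (simp add: crossings_def f_def g_def)
qed

section \<open>Existence of optimal solutions\<close>

text \<open>Induction on the family of blocks with a varying ground set: \<open>X - Y\<close> is
  ordered first and \<open>Y\<close> is appended as one run, which leaves the blocks already placed
  contiguous.\<close>

lemma ex_permutation_consecutive:
  assumes "finite F" "finite X" "\<Union>F \<subseteq> X" "pairwise disjnt F"
  shows "\<exists>p \<in> permutations_of_set X. \<forall>Y \<in> F. consecutive_in Y p"
  using assms
proof (induction F arbitrary: X rule: finite_induct)
  case empty
  then show ?case using finite_distinct_list[of X] by (auto simp: permutations_of_set_def)
next
  case (insert Y F)
  have "\<Union>F \<subseteq> X - Y"
  proof
    fix x assume "x \<in> \<Union>F"
    then obtain Z where Z: "Z \<in> F" "x \<in> Z" by blast
    then have "disjnt Y Z"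
      using insert.prems(3) insert.hyps(2) by (auto simp: pairwise_insert)
    then show "x \<in> X - Y" using Z insert.prems(2) by (auto simp: disjnt_def)
  qed
  then obtain p where p: "p \<in> permutations_of_set (X - Y)" "\<forall>Z \<in> F. consecutive_in Z p"
    using insert.IH[of "X - Y"] insert.prems by (auto simp: pairwise_insert)
  obtain ys where ys: "set ys = Y" "distinct ys"
    using finite_distinct_list[of Y] insert.prems by (auto intro: finite_subset)
  have "p @ ys \<in> permutations_of_set X"
    using p(1) ys insert.prems(2) by (auto simp: permutations_of_set_def)
  moreover have "\<forall>Z \<in> F. consecutive_in Z (p @ ys)"
    using p(2) sublist_order.order.trans[OF _ sublist_append_rightI[of p ys]]
    unfolding consecutive_in_def by metis
  moreover have "consecutive_in Y (p @ ys)"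
    using ys(1) sublist_append_leftI unfolding consecutive_in_def by metis
  ultimately show ?case by auto
qed

lemma finite_AC: "storyline_instance P \<Longrightarrow> finite (AC P t)"
  by (simp add: storyline_instance_def AC_def)

lemma ex_storyline_solution:
  assumes P: "storyline_instance P"
  shows "\<exists>S. storyline_solution P S"
proof -
  have "\<exists>p. p \<in> permutations_of_set (AC P t) \<and> (\<forall>I \<in> interactions_at P t. consecutive_in (ichars P I) p)"
    if "t \<in> set (steps P)" for t
  proof -
    let ?F = "ichars P ` interactions_at P t"
    have sub: "\<Union>?F \<subseteq> AC P t"
      using P by (auto simp: storyline_instance_def interactions_at_def)
    \<comment> \<open>All members are subsets of the finite set \<open>AC P t\<close>, so the family
      is finite even if infinitely many interactions share the step.\<close>
    then have "finite ?F"
      using finite_AC[OF P] by (meson Sup_le_iff finite_Pow_iff finite_subset PowI subsetI)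
    moreover have "pairwise disjnt ?F"
      using P that by (force simp: storyline_instance_def pairwise_def)
    ultimately show ?thesis
      using ex_permutation_consecutive[of ?F "AC P t"] sub finite_AC[OF P] by auto
  qed
  then obtain f where "\<And>t. t \<in> set (steps P) \<Longrightarrow> f t \<in> permutations_of_set (AC P t) \<and>
      (\<forall>I \<in> interactions_at P t. consecutive_in (ichars P I) (f t))"
    by metis
  then have "storyline_solution P (map f (steps P))"
    by (simp add: storyline_solution_def)
  then show ?thesis ..
qed

text \<open>Crossing numbers are naturals, so a minimum is attained once some solution
  exists.\<close>

lemma ex_optimal_solution:
  "storyline_instance P \<Longrightarrow> \<exists>S. is_arg_min crossings (storyline_solution P) S"
  by (metis ex_storyline_solution is_arg_min_arg_min_nat)

section \<open>Repairing a single step\<close>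

text \<open>\<open>retained P S i C\<close> is the common form of (2), (3) and (4).\<close>

definition retained :: "('t, 'c, 'i) storyline \<Rightarrow> 'c list list \<Rightarrow> nat \<Rightarrow> 'c set \<Rightarrow> bool" where
  "retained P S i C \<longleftrightarrow> (C \<subseteq> AC_range P (i - 1) i \<longrightarrow>
     restrict_perm (S ! i) C = restrict_perm (S ! (i - 1)) C)"

text \<open>Vacuous at a step without a unique interaction, so that it can be claimed for every
  index of a prefix.\<close>

definition order_retaining :: "('t, 'c, 'i) storyline \<Rightarrow> 'c list list \<Rightarrow> nat \<Rightarrow> bool" where
  "order_retaining P S i \<longleftrightarrow> (\<forall>I. interactions_at P (steps P ! i) = {I} \<longrightarrow>
     (\<exists>Ca Cb. Ca \<subseteq> AC P (steps P ! i) \<and> Cb \<subseteq> AC P (steps P ! i) \<and>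
        S ! i = restrict_perm (S ! i) Ca @ restrict_perm (S ! i) (ichars P I)
                  @ restrict_perm (S ! i) Cb \<and>
        retained P S i Ca \<and> retained P S i (ichars P I) \<and> retained P S i Cb))"

text \<open>Only the entries \<open>i - 1\<close> and \<open>i\<close> are read; this locality
  protects earlier steps from later repairs.\<close>

lemma order_retaining_cong:
  "S' ! i = S ! i \<Longrightarrow> S' ! (i - 1) = S ! (i - 1) \<Longrightarrow> order_retaining P S' i = order_retaining P S i"
  by (simp add: order_retaining_def retained_def)

lemma restrict_perm_self: "set xs \<subseteq> C \<Longrightarrow> restrict_perm xs C = xs"
  unfolding restrict_perm_def by (auto intro: filter_True)

lemma restrict_perm_disjoint: "set xs \<inter> C = {} \<Longrightarrow> restrict_perm xs C = []"
  unfolding restrict_perm_def by (auto simp: filter_empty_conv)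

lemma restrict_perm_append:
  "restrict_perm (xs @ ys) C = restrict_perm xs C @ restrict_perm ys C"
  by (simp add: restrict_perm_def)

text \<open>All or nothing: a block with an element missing from \<open>p\<close> is left alone,
  matching the conditional form of \<open>retained\<close>.\<close>

definition reorder :: "'c list \<Rightarrow> 'c list \<Rightarrow> 'c list" where
  "reorder p xs = (if set xs \<subseteq> set p then restrict_perm p (set xs) else xs)"

lemma set_reorder [simp]: "set (reorder p xs) = set xs"
  by (auto simp: reorder_def restrict_perm_def)

lemma distinct_reorder: "distinct p \<Longrightarrow> distinct xs \<Longrightarrow> distinct (reorder p xs)"
  by (simp add: reorder_def restrict_perm_def)

lemma precedes_reorder: "precedes (reorder p xs) c d \<Longrightarrow> precedes xs c d \<or> precedes p c d"
  by (auto simp: reorder_def precedes_restrict_perm split: if_splits)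

lemma AC_range_Suc: "AC_range P n (Suc n) = AC P (steps P ! n) \<inter> AC P (steps P ! Suc n)"
  by (auto simp: AC_range_def atLeastAtMostSuc_conv)

text \<open>The permutation is cut into the parts before, inside and after \<open>char(I)\<close>,
  and each part is reordered on its own. The parts keep their places and their sets, so
  \<open>I\<close> stays consecutive, and it is the only interaction to be respected at this
  step.\<close>

lemma repair_step:
  assumes opt: "is_arg_min crossings (storyline_solution P) S"
    and n: "Suc n < length (steps P)"
    and I: "interactions_at P (steps P ! Suc n) = {I}"
  shows "\<exists>q'. is_arg_min crossings (storyline_solution P) (S[Suc n := q']) \<and>
    order_retaining P (S[Suc n := q']) (Suc n)"
proof -
  let ?p = "S ! n" and ?q = "S ! Suc n"
  have sol: "storyline_solution P S" using opt by (simp add: is_arg_min_def)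
  have len: "length S = length (steps P)" using sol by (simp add: storyline_solution_def)
  have perm: "distinct (S ! i) \<and> set (S ! i) = AC P (steps P ! i)" if "i < length S" for i
    using sol that by (auto simp: storyline_solution_def permutations_of_set_def)
  have p: "distinct ?p" "set ?p = AC P (steps P ! n)" using perm n len by auto
  have q: "distinct ?q" "set ?q = AC P (steps P ! Suc n)" using perm n len by auto
  have "consecutive_in (ichars P I) ?q"
    using sol n I by (simp add: storyline_solution_def)
  \<comment> \<open>The sets of \<open>xs\<close> and \<open>zs\<close> will serve as
    \<open>Ca\<close> and \<open>Cb\<close>.\<close>
  then obtain xs ys zs where split: "?q = xs @ ys @ zs" and ys: "set ys = ichars P I"
    by (auto simp: consecutive_in_def sublist_def)
  define xs' where "xs' = reorder ?p xs"
  define ys' where "ys' = reorder ?p ys"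
  define zs' where "zs' = reorder ?p zs"
  define q' where "q' = xs' @ ys' @ zs'"
  define S' where "S' = S[Suc n := q']"
  have sets: "set xs' = set xs" "set ys' = set ys" "set zs' = set zs"
    by (simp_all add: xs'_def ys'_def zs'_def)
  have set_q': "set q' = set ?q" using split sets by (simp add: q'_def)
  have dist_q': "distinct q'"
    using q(1) p(1) unfolding q'_def xs'_def ys'_def zs'_def split
    by (simp add: distinct_reorder)
  have S'n: "S' ! n = ?p" "S' ! Suc n = q'" using n len by (auto simp: S'_def)
  have disj: "set xs \<inter> set ys = {}" "set xs \<inter> set zs = {}" "set ys \<inter> set zs = {}"
    using q(1) unfolding split by auto
  \<comment> \<open>The three parts are disjoint, so restricting \<open>q'\<close> to the set of one
    part recovers exactly that reordered part.\<close>
  have restr: "restrict_perm q' (set xs) = xs'" "restrict_perm q' (set ys) = ys'"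
    "restrict_perm q' (set zs) = zs'"
    using disj sets
    by (auto simp: q'_def restrict_perm_append restrict_perm_self restrict_perm_disjoint Int_commute)
  have "storyline_solution P S'"
    unfolding storyline_solution_def
  proof (intro conjI allI impI)
    show "length S' = length (steps P)" by (simp add: S'_def len)
    fix i assume i: "i < length (steps P)"
    show "S' ! i \<in> permutations_of_set (AC P (steps P ! i))"
    proof (cases "i = Suc n")
      case True
      then show ?thesis using S'n dist_q' set_q' q by (simp add: permutations_of_set_def)
    next
      case False
      then show ?thesis using sol i by (simp add: storyline_solution_def S'_def)
    qed
    show "\<forall>J \<in> interactions_at P (steps P ! i). consecutive_in (ichars P J) (S' ! i)"
    proof (cases "i = Suc n")
      case True
      have "consecutive_in (ichars P I) q'"
        unfolding consecutive_in_def q'_def using sets(2) ys sublist_appendI by metis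
      then show ?thesis using True I S'n by simp
    next
      case False
      then show ?thesis using sol i by (simp add: storyline_solution_def S'_def)
    qed
  qed
  moreover have "crossings S' \<le> crossings S"
    unfolding S'_def
  proof (rule crossings_update_le)
    \<comment> \<open>Elements of different parts keep their order from \<open>?q\<close>; within
      one part the order comes from \<open>?q\<close> or \<open>?p\<close>.\<close>
    show "precedes ?q c d \<or> precedes ?p c d" if "precedes q' c d" for c d
      using that sets unfolding q'_def split
      by (auto simp: precedes_append xs'_def ys'_def zs'_def dest!: precedes_reorder)
  qed (use n len perm dist_q' set_q' in auto)
  ultimately have "is_arg_min crossings (storyline_solution P) S'"
    using opt by (fastforce simp: is_arg_min_def)
  moreover have "order_retaining P S' (Suc n)"
  proof -
    \<comment> \<open>The premise of \<open>retained\<close> gives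
      \<open>set ws \<subseteq> set ?p\<close>, so \<open>reorder\<close> takes the branch that
      restricts \<open>?p\<close>, and \<open>?p\<close> is still entry \<open>n\<close> of
      \<open>S'\<close>.\<close>
    have keep: "retained P S' (Suc n) (set ws)" if "restrict_perm q' (set ws) = reorder ?p ws" for ws
      using that S'n p(2) by (simp add: retained_def AC_range_Suc reorder_def)
    have "retained P S' (Suc n) (set xs)" "retained P S' (Suc n) (ichars P I)"
      "retained P S' (Suc n) (set zs)"
      using keep[of xs] keep[of ys] keep[of zs] restr ys by (simp_all add: xs'_def ys'_def zs'_def)
    moreover have "set xs \<subseteq> AC P (steps P ! Suc n)" "set zs \<subseteq> AC P (steps P ! Suc n)"
      using q(2) split by auto
    moreover have "q' = restrict_perm q' (set xs) @ restrict_perm q' (ichars P I)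
        @ restrict_perm q' (set zs)"
      using restr ys by (simp add: q'_def)
    ultimately show ?thesis
      unfolding order_retaining_def S'n using I by (metis singleton_inject)
  qed
  ultimately show ?thesis unfolding S'_def by blast
qed

section \<open>Repairing all steps from left to right\<close>

lemma ex_order_retaining_prefix:
  assumes "storyline_instance P" "n < length (steps P)"
  shows "\<exists>S. is_arg_min crossings (storyline_solution P) S \<and>
    (\<forall>i \<in> {1..n}. order_retaining P S i)"
  using assms(2)
proof (induction n)
  case 0
  then show ?case using ex_optimal_solution[OF assms(1)] by auto
next
  case (Suc n)
  then obtain S where opt: "is_arg_min crossings (storyline_solution P) S"
    and prefix: "\<forall>i \<in> {1..n}. order_retaining P S i"
    by auto
  show ?case
  proof (cases "\<exists>I. interactions_at P (steps P ! Suc n) = {I}")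
    case True
    then obtain q' where q': "is_arg_min crossings (storyline_solution P) (S[Suc n := q'])"
      "order_retaining P (S[Suc n := q']) (Suc n)"
      using repair_step[OF opt Suc.prems] by blast
    \<comment> \<open>For \<open>i \<le> n\<close> neither \<open>i\<close> nor \<open>i - 1\<close>
      is the index \<open>Suc n\<close> of the changed entry.\<close>
    have "order_retaining P (S[Suc n := q']) i" if "i \<in> {1..n}" for i
      using prefix that order_retaining_cong[of "S[Suc n := q']" i S P] by auto
    then show ?thesis using q' by (auto simp: atLeastAtMostSuc_conv)
  next
    case False
    then have "order_retaining P S (Suc n)" by (simp add: order_retaining_def)
    then show ?thesis using opt prefix by (auto simp: atLeastAtMostSuc_conv)
  qed
qed

theorem theorem10:
  fixes P :: "('t, 'c, 'i) storyline"
  assumes "storyline_instance P"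
  shows "\<exists>S. is_arg_min crossings (storyline_solution P) S \<and>
    (\<forall>i I. 1 \<le> i \<and> i < length (steps P) \<and> interactions_at P (steps P ! i) = {I} \<longrightarrow>
      (\<exists>Ca Cb. Ca \<subseteq> AC P (steps P ! i) \<and> Cb \<subseteq> AC P (steps P ! i) \<and>
        S ! i = restrict_perm (S ! i) Ca @ restrict_perm (S ! i) (ichars P I)
                  @ restrict_perm (S ! i) Cb \<and>
        (Ca \<subseteq> AC_range P (i - 1) i \<longrightarrow>
           restrict_perm (S ! i) Ca = restrict_perm (S ! (i - 1)) Ca) \<and>
        (ichars P I \<subseteq> AC_range P (i - 1) i \<longrightarrow>
           restrict_perm (S ! i) (ichars P I) = restrict_perm (S ! (i - 1)) (ichars P I)) \<and>
        (Cb \<subseteq> AC_range P (i - 1) i \<longrightarrow>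
           restrict_perm (S ! i) Cb = restrict_perm (S ! (i - 1)) Cb)))"
proof -
  obtain S where opt: "is_arg_min crossings (storyline_solution P) S"
    and retaining: "\<forall>i \<in> {1..length (steps P) - 1}. order_retaining P S i"
  \<comment> \<open>Without time steps, \<open>length (steps P) - 1\<close> is truncated to 0, which
    is not a valid index. The range of \<open>i\<close> is then empty and any optimal solution will
    do.\<close>
  proof (cases "steps P = []")
    case True
    then show ?thesis
      using that ex_optimal_solution[OF assms] by auto
  next
    case False
    then show ?thesis
      using that ex_order_retaining_prefix[OF assms, of "length (steps P) - 1"] by auto
  qed
  show ?thesis
  proof (intro exI[of _ S] conjI allI impI opt)
    fix i I
    assume i: "1 \<le> i \<and> i < length (steps P) \<and> interactions_at P (steps P ! i) = {I}"
    then have "order_retaining P S i" using retaining by auto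
    then show "\<exists>Ca Cb. Ca \<subseteq> AC P (steps P ! i) \<and> Cb \<subseteq> AC P (steps P ! i) \<and>
        S ! i = restrict_perm (S ! i) Ca @ restrict_perm (S ! i) (ichars P I)
                  @ restrict_perm (S ! i) Cb \<and>
        (Ca \<subseteq> AC_range P (i - 1) i \<longrightarrow>
           restrict_perm (S ! i) Ca = restrict_perm (S ! (i - 1)) Ca) \<and>
        (ichars P I \<subseteq> AC_range P (i - 1) i \<longrightarrow>
           restrict_perm (S ! i) (ichars P I) = restrict_perm (S ! (i - 1)) (ichars P I)) \<and>
        (Cb \<subseteq> AC_range P (i - 1) i \<longrightarrow>
           restrict_perm (S ! i) Cb = restrict_perm (S ! (i - 1)) Cb)"
      using i unfolding order_retaining_def retained_def by blast
  qed
qed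

end
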